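(* Let $-\pi/2<\alpha<\pi/2$ and $0\le\beta<1$, and let $f\in\mathcal{S}_{\alpha}(\beta)$. Then the Schwarzian norm $\|S_f\|$ satisfies $$\|S_f\|\le \begin{cases} \dfrac{2(1-\beta)\cos\alpha}{1-\sqrt{\sin^2\alpha+\beta^2\cos^2\alpha}} & \text{if } \sin^2\alpha+\beta^2\cos^2\alpha\le 1/4,\\[4mm] 8(1-\beta)\cos\alpha\,\sqrt{\sin^2\alpha+\beta^2\cos^2\alpha} & \text{if } \sin^2\alpha+\beta^2\cos^2\alpha>1/4. \end{cases}$$ Moreover, the estimates are best possible: for each such $\alpha$ and $\beta$, the right-hand side cannot be replaced by a smaller number valid for all $f\in\mathcal{S}_{\alpha}(\beta)$.
   Context: $\mathbb{D}=\{z\in\mathbb{C}:|z|<1\}$ is the open unit disk. $\mathcal{A}$ is the class of analytic functions $f$ on $\mathbb{D}$ with $f(0)=0$ and $f'(0)=1$. For $-\pi/2<\alpha<\pi/2$ and $0\le\beta<1$, $\mathcal{S}_{\alpha}(\beta)$ is the class of $f\in\mathcal{A}$ that are locally univalent ($f'(z)\neq 0$ for all $z\in\mathbb{D}$, which is implicit in the following condition) and satisfy $$\operatorname{Re}\left\{e^{i\alpha}\left(1+\frac{zf''(z)}{f'(z)}\right)\right\}>\beta\cos\alpha\quad\text{for all } z\in\mathbb{D}.$$ The Schwarzian derivative and Schwarzian norm of a locally univalent analytic function $f$ on $\mathbb{D}$ are $$S_f(z)=\left(\frac{f''(z)}{f'(z)}\right)'-\frac12\left(\frac{f''(z)}{f'(z)}\right)^2,\qquad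 \|S_f\|=\sup_{z\in\mathbb{D}}(1-|z|^2)^2|S_f(z)|.$$ *)

theory Defs
  imports "HOL-Complex_Analysis.Complex_Analysis" "HOL-Library.Extended_Real"
begin

abbreviation unit_disk :: "complex set" (\<open>\<D>\<close>)
  where "\<D> \<equiv> ball 0 1"

text \<open>
  A function on the disk is represented by a total function; its values outside the open
  set \<open>\<D>\<close> are arbitrary and affect none of the notions below, since all derivatives are
  taken at points of \<open>\<D>\<close>.
\<close>

definition normalized_analytic :: "(complex \<Rightarrow> complex) set" (\<open>\<A>\<close>)
  where "\<A> = {f. f analytic_on \<D> \<and> f 0 = 0 \<and> deriv f 0 = 1}"

definition locally_univalent :: "(complex \<Rightarrow> complex) \<Rightarrow> bool"
  where "locally_univalent f \<longleftrightarrow> (\<forall>z\<in>\<D>. deriv f z \<noteq> 0)"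

text \<open>
  Local univalence has to be a separate conjunct: as \<open>x / 0 = 0\<close>, the inequality below would
  otherwise hold at a zero of the derivative.
\<close>

definition S_class :: "real \<Rightarrow> real \<Rightarrow> (complex \<Rightarrow> complex) set"
  where "S_class \<alpha> \<beta> = {f \<in> \<A>. locally_univalent f \<and>
    (\<forall>z\<in>\<D>. Re (exp (\<i> * of_real \<alpha>) * (1 + z * deriv (deriv f) z / deriv f z)) > \<beta> * cos \<alpha>)}"

definition schwarzian :: "(complex \<Rightarrow> complex) \<Rightarrow> complex \<Rightarrow> complex"
  where "schwarzian f z = deriv (\<lambda>w. deriv (deriv f) w / deriv f w) z
    - 1 / 2 * (deriv (deriv f) z / deriv f z)\<^sup>2"

text \<open>The supremum is taken in \<^typ>\<open>ereal\<close>, so that an unbounded family has norm \<open>\<infinity>\<close>.\<close>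

definition schwarzian_norm :: "(complex \<Rightarrow> complex) \<Rightarrow> ereal"
  where "schwarzian_norm f = (SUP z\<in>\<D>. ereal ((1 - (cmod z)\<^sup>2)\<^sup>2 * cmod (schwarzian f z)))"

definition schwarzian_bound :: "real \<Rightarrow> real \<Rightarrow> real"
  where "schwarzian_bound \<alpha> \<beta> =
    (if (sin \<alpha>)\<^sup>2 + \<beta>\<^sup>2 * (cos \<alpha>)\<^sup>2 \<le> 1 / 4
     then 2 * (1 - \<beta>) * cos \<alpha> / (1 - sqrt ((sin \<alpha>)\<^sup>2 + \<beta>\<^sup>2 * (cos \<alpha>)\<^sup>2))
     else 8 * (1 - \<beta>) * cos \<alpha> * sqrt ((sin \<alpha>)\<^sup>2 + \<beta>\<^sup>2 * (cos \<alpha>)\<^sup>2))"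

end

theory Submission
  imports Defs
begin

text \<open>
  Put \<open>k = (1 - \<beta>) cos \<alpha> e\<^sup>-\<^sup>i\<^sup>\<alpha>\<close> and \<open>d = |1 - k|\<close>, so that \<open>d\<^sup>2 = sin\<^sup>2 \<alpha> + \<beta>\<^sup>2 cos\<^sup>2 \<alpha> < 1\<close>.
  A Cayley transform and Schwarz's lemma turn the half-plane condition defining the class into
  the representation \<open>f'' / f' = 2 k \<phi> / (1 - z \<phi>)\<close>, in which \<open>\<phi>\<close> runs through all holomorphic maps
  of the disk into the closed disk (\<open>S_class_representation\<close>, \<open>S_class_construction\<close>).
  Differentiating it gives \<open>S\<^sub>f = 2 k (\<phi>' + (1 - k) \<phi>\<^sup>2) / (1 - z \<phi>)\<^sup>2\<close>.

  At a point \<open>z\<close> with \<open>|z| = r\<close> and \<open>|\<phi> z| = t\<close>, the Schwarz-Pick inequality bounds \<open>|\<phi>'|\<close> by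
  \<open>(1 - t\<^sup>2) / (1 - r\<^sup>2)\<close>, while \<open>|1 - z \<phi>| \<ge> 1 - r t\<close>. In the pseudo-hyperbolic coordinate
  \<open>u = (t - r) / (1 - r t)\<close> the resulting bound collapses to a quadratic polynomial:
  \<open>(1 - r\<^sup>2)\<^sup>2 |S\<^sub>f| \<le> 2 |k| (1 - u\<^sup>2 + d (u + r)\<^sup>2)\<close>. As \<open>0 \<le> u + r \<le> u + 1\<close>, it remains to maximize
  \<open>1 - u\<^sup>2 + d (u + 1)\<^sup>2\<close> over \<open>u \<in> [-1, 1]\<close>. The vertex \<open>u = d / (1 - d)\<close> lies in the interval
  exactly when \<open>d \<le> 1/2\<close>, and otherwise the maximum is at \<open>u = 1\<close>; these are the two cases
  of the estimate.

  Every inequality used before letting \<open>r\<close> tend to \<open>1\<close> is an equality for a suitable Blaschke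
  factor \<open>\<phi>\<close> (a constant if \<open>u = 1\<close>): prescribe the value \<open>t\<close> at the point \<open>r\<close> and
  rotate the derivative there to have the argument of \<open>1 - k\<close>. Keeping \<open>u\<close> at the
  maximum and letting \<open>r\<close> tend to \<open>1\<close> shows that the bound is sharp.
\<close>

section \<open>The Schwarz-Pick inequality and its extremal functions\<close>

lemma one_minus_nonzero_of_norm_less:
  fixes w :: complex
  assumes "cmod w < 1"
  shows "1 - w \<noteq> 0" "1 + w \<noteq> 0"
proof -
  show "1 - w \<noteq> 0" using assms by auto
  show "1 + w \<noteq> 0" using assms
    by (metis add_eq_0_iff norm_minus_cancel norm_one order_less_irrefl)
qed

lemma norm_mult_less_one:
  fixes a b :: complex
  assumes "cmod a < 1" "cmod b \<le> 1"
  shows "cmod (a * b) < 1"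
  using assms mult_left_le[of "cmod b" "cmod a"] by (simp add: norm_mult)

lemma Moebius_function_has_field_derivative:
  assumes "1 - cnj w * z \<noteq> 0"
  shows "(Moebius_function 0 w has_field_derivative (1 - (cmod w)\<^sup>2) / (1 - cnj w * z)\<^sup>2) (at z)"
proof -
  have *: "of_real ((cmod w)\<^sup>2) = w * cnj w"
    using complex_norm_square by blast
  have "((\<lambda>z. (z - w) / (1 - cnj w * z)) has_field_derivative
      (1 - (cmod w)\<^sup>2) / (1 - cnj w * z)\<^sup>2) (at z)"
    by (rule derivative_eq_intros refl assms)+
       (use assms * in \<open>simp add: field_simps power2_eq_square\<close>)
  then show ?thesis
    by (simp add: Moebius_function_simple[abs_def])
qed

lemma Schwarz_Pick_strict:
  assumes hol: "f holomorphic_on \<D>" and bd: "\<And>z. cmod z < 1 \<Longrightarrow> cmod (f z) < 1"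
    and a: "cmod a < 1"
  shows "cmod (deriv f a) * (1 - (cmod a)\<^sup>2) \<le> 1 - (cmod (f a))\<^sup>2"
proof -
  let ?A = "Moebius_function 0 (- a)" and ?B = "Moebius_function 0 (f a)"
  define g where "g = ?B \<circ> (f \<circ> ?A)"
  have fa: "cmod (f a) < 1" using bd a by blast
  have Abd: "cmod (?A z) < 1" if "cmod z < 1" for z
    using Moebius_function_norm_lt_1[of "- a" z 0] a that by simp
  have A0: "?A 0 = a"
    by (simp add: Moebius_function_of_zero)
  have "g holomorphic_on \<D>"
    unfolding g_def
  proof (intro holomorphic_on_compose_gen[where t = \<D>])
    show "?A holomorphic_on \<D>" "?B holomorphic_on \<D>"
      using a fa by (auto intro: Moebius_function_holomorphic)
  qed (use hol Abd bd in auto)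
  moreover have "g 0 = 0"
    by (simp add: g_def A0 Moebius_function_eq_zero)
  moreover have "cmod (g z) < 1" if "cmod z < 1" for z
    unfolding g_def using that Abd bd fa by (auto intro!: Moebius_function_norm_lt_1)
  ultimately have le: "cmod (deriv g 0) \<le> 1"
    using Schwarz_Lemma(2)[of g 0] by simp
  have fnz: "1 - cnj (f a) * f a \<noteq> 0"
    using norm_mult_less_one[of "cnj (f a)" "f a"] fa by auto
  have sq: "1 - cnj (f a) * f a = of_real (1 - (cmod (f a))\<^sup>2)"
    using complex_norm_square[of "f a"] by (simp add: mult.commute)
  have dA: "(?A has_field_derivative of_real (1 - (cmod a)\<^sup>2)) (at 0)"
    using Moebius_function_has_field_derivative[of "- a" 0] by simp
  have df: "(f has_field_derivative deriv f a) (at (?A 0))"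
    unfolding A0 using hol a by (intro holomorphic_derivI[of _ \<D>]) auto
  have dB: "(?B has_field_derivative of_real (1 - (cmod (f a))\<^sup>2) / (1 - cnj (f a) * f a)\<^sup>2)
      (at ((f \<circ> ?A) 0))"
    using Moebius_function_has_field_derivative[OF fnz] by (simp add: A0)
  have "(g has_field_derivative
      of_real (1 - (cmod (f a))\<^sup>2) / (1 - cnj (f a) * f a)\<^sup>2 *
      (deriv f a * of_real (1 - (cmod a)\<^sup>2))) (at 0)"
    unfolding g_def by (intro DERIV_chain dA df dB)
  from DERIV_imp_deriv[OF this]
  have dg: "deriv g 0 = deriv f a * of_real (1 - (cmod a)\<^sup>2) / of_real (1 - (cmod (f a))\<^sup>2)"
    using fnz unfolding sq by (simp add: power2_eq_square)
  have "(cmod a)\<^sup>2 < 1" "(cmod (f a))\<^sup>2 < 1"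
    using a fa by (simp_all add: power_less_one_iff)
  then show ?thesis
    using le unfolding dg norm_divide norm_mult norm_of_real
    by (simp add: divide_le_eq)
qed

text \<open>
  The weak bound \<open>|f| \<le> 1\<close> admits unimodular constants, for which the Moebius transformations
  in the strict case degenerate. Applying that case to \<open>s f\<close> and letting \<open>s\<close> tend to \<open>1\<close>
  covers both.
\<close>

lemma Schwarz_Pick:
  assumes hol: "f holomorphic_on \<D>" and bd: "\<And>z. cmod z < 1 \<Longrightarrow> cmod (f z) \<le> 1"
    and a: "cmod a < 1"
  shows "cmod (deriv f a) * (1 - (cmod a)\<^sup>2) \<le> 1 - (cmod (f a))\<^sup>2"
proof -
  have *: "s * cmod (deriv f a) * (1 - (cmod a)\<^sup>2) \<le> 1 - (s * cmod (f a))\<^sup>2"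
    if s: "0 < s" "s < 1" for s :: real
  proof -
    have "cmod (deriv (\<lambda>z. of_real s * f z) a) * (1 - (cmod a)\<^sup>2)
        \<le> 1 - (cmod (of_real s * f a))\<^sup>2"
    proof (rule Schwarz_Pick_strict[OF _ _ a])
      show "(\<lambda>z. of_real s * f z) holomorphic_on \<D>"
        by (intro holomorphic_intros hol)
      show "cmod (of_real s * f z) < 1" if "cmod z < 1" for z
        using norm_mult_less_one[of "of_real s" "f z"] bd[OF that] s by simp
    qed
    moreover have "deriv (\<lambda>z. of_real s * f z) a = of_real s * deriv f a"
      using hol a by (intro DERIV_imp_deriv DERIV_cmult holomorphic_derivI[of _ \<D>]) auto
    ultimately show ?thesis
      using s by (simp add: norm_mult)
  qed
  have "((\<lambda>s. s * cmod (deriv f a) * (1 - (cmod a)\<^sup>2)) \<longlongrightarrow>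
      1 * cmod (deriv f a) * (1 - (cmod a)\<^sup>2)) (at_left (1::real))"
    by (intro tendsto_intros)
  moreover have "((\<lambda>s. 1 - (s * cmod (f a))\<^sup>2) \<longlongrightarrow> 1 - (1 * cmod (f a))\<^sup>2) (at_left (1::real))"
    by (intro tendsto_intros)
  moreover have "eventually (\<lambda>s. s * cmod (deriv f a) * (1 - (cmod a)\<^sup>2)
      \<le> 1 - (s * cmod (f a))\<^sup>2) (at_left (1::real))"
    using eventually_at_left_real[of 0 "1::real"] by (rule eventually_mono) (use * in auto)
  ultimately have "1 * cmod (deriv f a) * (1 - (cmod a)\<^sup>2) \<le> 1 - (1 * cmod (f a))\<^sup>2"
    by (intro tendsto_le[OF trivial_limit_at_left_real]) auto
  then show ?thesis by simp
qed

lemma norm_add_le_norm_one_add_mult: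
  fixes w :: complex and t :: real
  assumes "cmod w \<le> 1" "0 \<le> t" "t \<le> 1"
  shows "cmod (w + of_real t) \<le> cmod (1 + of_real t * w)"
proof -
  have "(cmod (1 + of_real t * w))\<^sup>2 - (cmod (w + of_real t))\<^sup>2 = (1 - t\<^sup>2) * (1 - (cmod w)\<^sup>2)"
    unfolding cmod_power2 by (simp add: algebra_simps power2_eq_square)
  moreover have "t\<^sup>2 \<le> 1" "(cmod w)\<^sup>2 \<le> 1"
    using assms by (simp_all add: power_le_one)
  ultimately have "(cmod (w + of_real t))\<^sup>2 \<le> (cmod (1 + of_real t * w))\<^sup>2"
    by (smt (verit) mult_nonneg_nonneg)
  then show ?thesis
    by (simp add: power2_le_iff_abs_le)
qed

text \<open>
  Equality in the Schwarz-Pick inequality at \<open>a\<close> is attained with any prescribed value in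
  \<open>[0, 1]\<close> and any prescribed argument of the derivative: rotate the disk automorphism that sends
  \<open>a\<close> to \<open>0\<close>, and then send \<open>0\<close> to the prescribed value.
\<close>

lemma Schwarz_Pick_extremal:
  fixes a \<epsilon> :: complex and t :: real
  assumes a: "cmod a < 1" and t: "0 \<le> t" "t \<le> 1" and \<epsilon>: "cmod \<epsilon> = 1"
  obtains f where "f holomorphic_on \<D>" "\<And>z. cmod z < 1 \<Longrightarrow> cmod (f z) \<le> 1"
    "f a = of_real t" "deriv f a = \<epsilon> * of_real ((1 - t\<^sup>2) / (1 - (cmod a)\<^sup>2))"
proof -
  define \<psi> where "\<psi> = (\<lambda>z. \<epsilon> * Moebius_function 0 a z)"
  define f where "f = (\<lambda>z. (\<psi> z + of_real t) / (1 + of_real t * \<psi> z))"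
  have \<psi>bd: "cmod (\<psi> z) < 1" if "cmod z < 1" for z
    using Moebius_function_norm_lt_1[OF a that, of 0] \<epsilon> by (simp add: \<psi>_def norm_mult)
  have nz: "1 + of_real t * \<psi> z \<noteq> 0" if "cmod z < 1" for z
    using norm_mult_less_one[OF \<psi>bd[OF that], of "of_real t"] t
    by (intro one_minus_nonzero_of_norm_less) (simp add: mult.commute)
  have hol\<psi>: "\<psi> holomorphic_on \<D>"
    unfolding \<psi>_def by (intro holomorphic_intros Moebius_function_holomorphic a)
  have \<psi>a: "\<psi> a = 0"
    by (simp add: \<psi>_def Moebius_function_eq_zero)
  have anz: "1 - cnj a * a \<noteq> 0"
    using norm_mult_less_one[of "cnj a" a] a by auto
  have sq: "1 - cnj a * a = of_real (1 - (cmod a)\<^sup>2)"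
    using complex_norm_square[of a] by (simp add: mult.commute)
  have d\<psi>: "(\<psi> has_field_derivative \<epsilon> / of_real (1 - (cmod a)\<^sup>2)) (at a)"
  proof -
    have "(\<psi> has_field_derivative \<epsilon> * (of_real (1 - (cmod a)\<^sup>2) / (1 - cnj a * a)\<^sup>2)) (at a)"
      unfolding \<psi>_def using Moebius_function_has_field_derivative[OF anz]
      by (intro DERIV_cmult) simp
    then show ?thesis
      using anz unfolding sq by (simp add: power2_eq_square)
  qed
  show thesis
  proof (rule that)
    show "f holomorphic_on \<D>"
      unfolding f_def using nz by (intro holomorphic_intros hol\<psi>) auto
    show "cmod (f z) \<le> 1" if "cmod z < 1" for z
      using norm_add_le_norm_one_add_mult[OF less_imp_le[OF \<psi>bd[OF that]] t] nz[OF that]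
      by (simp add: f_def norm_divide)
    show "f a = of_real t"
      by (simp add: f_def \<psi>a)
    have "(f has_field_derivative \<epsilon> * of_real ((1 - t\<^sup>2) / (1 - (cmod a)\<^sup>2))) (at a)"
      unfolding f_def
      by (rule derivative_eq_intros d\<psi> refl nz[OF a])+
         (simp add: \<psi>a algebra_simps power2_eq_square diff_divide_distrib)
    then show "deriv f a = \<epsilon> * of_real ((1 - t\<^sup>2) / (1 - (cmod a)\<^sup>2))"
      by (rule DERIV_imp_deriv)
  qed
qed

section \<open>Parametrization of the class by self-maps of the disk\<close>

definition spiral_coeff :: "real \<Rightarrow> real \<Rightarrow> complex"
  where "spiral_coeff \<alpha> \<beta> = of_real ((1 - \<beta>) * cos \<alpha>) * exp (- (\<i> * of_real \<alpha>))"

lemma exp_spiral_coeff: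
  "exp (\<i> * of_real \<alpha>) * spiral_coeff \<alpha> \<beta> = of_real ((1 - \<beta>) * cos \<alpha>)"
  by (simp add: spiral_coeff_def exp_minus)

lemma norm_spiral_coeff:
  assumes "0 < cos \<alpha>" "\<beta> < 1"
  shows "cmod (spiral_coeff \<alpha> \<beta>) = (1 - \<beta>) * cos \<alpha>"
  using assms unfolding spiral_coeff_def norm_mult norm_of_real norm_exp_eq_Re by simp

lemma norm_one_minus_spiral_coeff:
  "cmod (1 - spiral_coeff \<alpha> \<beta>) = sqrt ((sin \<alpha>)\<^sup>2 + \<beta>\<^sup>2 * (cos \<alpha>)\<^sup>2)"
proof -
  have *: "exp (- (\<i> * of_real \<alpha>)) = cis (- \<alpha>)"
    by (simp add: cis_conv_exp)
  have s: "(sin \<alpha>)\<^sup>2 = 1 - (cos \<alpha>)\<^sup>2"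
    by (rule sin_squared_eq)
  have "(1 - (1 - \<beta>) * (cos \<alpha>)\<^sup>2)\<^sup>2 + ((1 - \<beta>) * cos \<alpha>)\<^sup>2 * (sin \<alpha>)\<^sup>2
      = (sin \<alpha>)\<^sup>2 + \<beta>\<^sup>2 * (cos \<alpha>)\<^sup>2"
    unfolding s by algebra
  then show ?thesis
    unfolding spiral_coeff_def * cmod_def
    by (simp add: power2_eq_square mult_ac)
qed

lemma deriv_log_deriv_holomorphic:
  assumes "f holomorphic_on \<D>" "\<And>z. cmod z < 1 \<Longrightarrow> deriv f z \<noteq> 0"
  shows "(\<lambda>z. deriv (deriv f) z / deriv f z) holomorphic_on \<D>"
  by (rule holomorphic_on_divide[OF holomorphic_deriv[OF holomorphic_deriv[OF assms(1)]]
        holomorphic_deriv[OF assms(1)]]) (use assms(2) in simp_all)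

text \<open>
  With \<open>P = f'' / f'\<close>, the function \<open>p = 1 + z P\<close> sends \<open>0\<close> to \<open>1\<close> and has its values, after rotation by
  \<open>\<alpha>\<close>, in a half-plane; the Cayley transform of that half-plane onto the disk turns \<open>p\<close> into
  \<open>\<omega> = z P / (2 k + z P)\<close>. So \<open>\<phi> = \<omega> / z\<close> has the closed form \<open>P / (2 k + z P)\<close>, which is visibly
  holomorphic at the origin, and Schwarz's lemma gives \<open>|\<phi>| \<le> 1\<close>.
\<close>

lemma S_class_representation:
  assumes \<alpha>: "0 < cos \<alpha>" and \<beta>: "\<beta> < 1" and f: "f \<in> S_class \<alpha> \<beta>"
  obtains \<phi> where "\<phi> holomorphic_on \<D>" "\<And>z. cmod z < 1 \<Longrightarrow> cmod (\<phi> z) \<le> 1"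
    "\<And>z. cmod z < 1 \<Longrightarrow>
      deriv (deriv f) z / deriv f z = 2 * spiral_coeff \<alpha> \<beta> * \<phi> z / (1 - z * \<phi> z)"
proof -
  define k where "k = spiral_coeff \<alpha> \<beta>"
  define c where "c = (1 - \<beta>) * cos \<alpha>"
  define e where "e = exp (\<i> * of_real \<alpha>)"
  define P where "P = (\<lambda>z. deriv (deriv f) z / deriv f z)"
  have c: "0 < c" using \<alpha> \<beta> by (simp add: c_def)
  have e: "cmod e = 1" "Re e = cos \<alpha>" by (simp_all add: e_def Re_exp)
  have ek: "e * k = of_real c" unfolding e_def k_def c_def by (rule exp_spiral_coeff)
  have k: "k \<noteq> 0" using ek c by auto
  have holf: "f holomorphic_on \<D>" and df: "\<And>z. cmod z < 1 \<Longrightarrow> deriv f z \<noteq> 0"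
    and re: "\<And>z. cmod z < 1 \<Longrightarrow> Re (e * (1 + z * P z)) > \<beta> * cos \<alpha>"
    using f by (auto simp: S_class_def normalized_analytic_def locally_univalent_def
        analytic_imp_holomorphic e_def P_def)
  have holP: "P holomorphic_on \<D>"
    unfolding P_def using holf df by (rule deriv_log_deriv_holomorphic)
  have re': "Re (e * (z * P z)) > - c" if "cmod z < 1" for z
    using re[OF that] e(2) by (simp add: c_def algebra_simps)
  have lt: "cmod (z * P z) < cmod (2 * k + z * P z)" if "cmod z < 1" for z
  proof -
    let ?w = "e * (z * P z)"
    have "(cmod ?w)\<^sup>2 < (cmod (2 * of_real c + ?w))\<^sup>2"
      using re'[OF that] mult_strict_left_mono[OF re'[OF that] c]
      unfolding cmod_power2 by (simp add: algebra_simps power2_eq_square)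
    then have "cmod ?w < cmod (2 * of_real c + ?w)"
      by (simp add: power2_less_imp_less)
    also have "2 * of_real c + ?w = e * (2 * k + z * P z)"
      by (simp add: algebra_simps flip: ek)
    finally show ?thesis
      by (simp add: norm_mult e(1))
  qed
  have nz: "2 * k + z * P z \<noteq> 0" if "cmod z < 1" for z
    using lt[OF that] by (smt (verit) norm_ge_zero norm_zero)
  define \<phi> where "\<phi> = (\<lambda>z. P z / (2 * k + z * P z))"
  have hol\<phi>: "\<phi> holomorphic_on \<D>"
    unfolding \<phi>_def using nz by (intro holomorphic_intros holP) auto
  have \<omega>: "cmod (z * \<phi> z) < 1" if "cmod z < 1" for z
    using lt[OF that] nz[OF that] by (simp add: \<phi>_def norm_divide flip: norm_mult)
  have hol\<omega>: "(\<lambda>z. z * \<phi> z) holomorphic_on \<D>"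
    by (intro holomorphic_intros hol\<phi>)
  have le: "cmod (\<phi> z) \<le> 1" if z: "cmod z < 1" for z
  proof (cases "z = 0")
    case False
    have "cmod (z * \<phi> z) \<le> cmod z"
      using Schwarz_Lemma(1)[OF hol\<omega> _ \<omega> z] by simp
    then show ?thesis using False by (simp add: norm_mult)
  next
    case True
    have "(\<phi> has_field_derivative deriv \<phi> 0) (at 0)"
      using hol\<phi> by (intro holomorphic_derivI[of _ \<D>]) auto
    then have "((\<lambda>z. z * \<phi> z) has_field_derivative \<phi> 0) (at 0)"
      using DERIV_mult[OF DERIV_ident] by fastforce
    then have "deriv (\<lambda>z. z * \<phi> z) 0 = \<phi> 0"
      by (rule DERIV_imp_deriv)
    then show ?thesis
      using Schwarz_Lemma(2)[OF hol\<omega> _ \<omega> z] True by simp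
  qed
  show thesis
  proof (rule that[OF hol\<phi> le])
    fix z :: complex assume z: "cmod z < 1"
    have "1 - z * \<phi> z = 2 * k / (2 * k + z * P z)"
      using nz[OF z] by (simp add: \<phi>_def field_simps)
    then show "deriv (deriv f) z / deriv f z = 2 * spiral_coeff \<alpha> \<beta> * \<phi> z / (1 - z * \<phi> z)"
      using nz[OF z] k by (simp add: \<phi>_def flip: P_def k_def)
         (simp add: P_def)
  qed
qed

text \<open>
  Conversely, two integrations recover \<open>f\<close> from the holomorphic function \<open>f'' / f'\<close>: exponentiating
  a primitive yields \<open>f'\<close>, which therefore has no zeros.
\<close>

lemma prescribed_log_deriv_deriv:
  assumes P: "P holomorphic_on \<D>"
  obtains f where "f \<in> \<A>" "locally_univalent f"
    "\<And>z. cmod z < 1 \<Longrightarrow> deriv (deriv f) z / deriv f z = P z"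
proof -
  obtain G where G: "\<And>z. z \<in> \<D> \<Longrightarrow> (G has_field_derivative P z) (at z within \<D>)"
    using holomorphic_convex_primitive'[OF _ _ P] by auto
  have G': "(G has_field_derivative P z) (at z)" if "z \<in> \<D>" for z
    using G[OF that] that by (simp add: at_within_open[of _ \<D>])
  define E where "E = (\<lambda>z. exp (G z - G 0))"
  have E': "(E has_field_derivative E z * P z) (at z)" if "z \<in> \<D>" for z
    unfolding E_def by (rule derivative_eq_intros G' that refl)+ simp
  have holE: "E holomorphic_on \<D>"
    using E' by (subst holomorphic_on_open) (auto intro!: exI)
  obtain F where F: "\<And>z. z \<in> \<D> \<Longrightarrow> (F has_field_derivative E z) (at z within \<D>)"
    using holomorphic_convex_primitive'[OF _ _ holE] by auto
  have F': "(F has_field_derivative E z) (at z)" if "z \<in> \<D>" for z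
    using F[OF that] that by (simp add: at_within_open[of _ \<D>])
  define f where "f = (\<lambda>z. F z - F 0)"
  have f': "(f has_field_derivative E z) (at z)" if "z \<in> \<D>" for z
    unfolding f_def by (rule derivative_eq_intros F' that refl)+ simp
  have df: "deriv f z = E z" if "z \<in> \<D>" for z
    using f'[OF that] by (rule DERIV_imp_deriv)
  have ddf: "deriv (deriv f) z = E z * P z" if "z \<in> \<D>" for z
    by (intro DERIV_imp_deriv has_field_derivative_transform_within_open[OF E'[OF that] _ that])
       (auto simp: df)
  show thesis
  proof (rule that)
    have "f holomorphic_on \<D>"
      using f' by (subst holomorphic_on_open) (auto intro!: exI)
    then show "f \<in> \<A>"
      by (simp add: normalized_analytic_def analytic_on_open df) (simp add: f_def E_def)
    show "locally_univalent f"
      by (auto simp: locally_univalent_def df) (simp add: E_def)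
    show "deriv (deriv f) z / deriv f z = P z" if "cmod z < 1" for z
      using that by (simp add: df ddf) (simp add: E_def)
  qed
qed

lemma Re_divide_one_minus_gt:
  assumes "cmod w < 1"
  shows "Re (w / (1 - w)) > - 1 / 2"
proof -
  have n: "1 - w \<noteq> 0" using assms by auto
  then have pos: "0 < (cmod (1 - w))\<^sup>2" by simp
  have "(cmod w)\<^sup>2 < 1"
    using assms by (simp add: power_less_one_iff)
  then have "- (cmod (1 - w))\<^sup>2 < 2 * Re (w * cnj (1 - w))"
    unfolding cmod_power2 by (simp add: algebra_simps power2_eq_square)
  moreover have "Re (w / (1 - w)) = Re (w * cnj (1 - w)) / (cmod (1 - w))\<^sup>2"
    unfolding Re_divide cmod_power2 by (simp add: algebra_simps)
  ultimately show ?thesis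
    using pos by (simp only: pos_less_divide_eq)
qed

lemma S_class_construction:
  assumes \<alpha>: "0 < cos \<alpha>" and \<beta>: "\<beta> < 1"
    and \<phi>: "\<phi> holomorphic_on \<D>" "\<And>z. cmod z < 1 \<Longrightarrow> cmod (\<phi> z) \<le> 1"
  obtains f where "f \<in> S_class \<alpha> \<beta>"
    "\<And>z. cmod z < 1 \<Longrightarrow>
      deriv (deriv f) z / deriv f z = 2 * spiral_coeff \<alpha> \<beta> * \<phi> z / (1 - z * \<phi> z)"
proof -
  define c where "c = (1 - \<beta>) * cos \<alpha>"
  have c: "0 < c" using \<alpha> \<beta> by (simp add: c_def)
  let ?k = "spiral_coeff \<alpha> \<beta>"
  have lt: "cmod (z * \<phi> z) < 1" if "cmod z < 1" for z
    using norm_mult_less_one[OF that \<phi>(2)[OF that]] .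
  have hol: "(\<lambda>z. 2 * ?k * \<phi> z / (1 - z * \<phi> z)) holomorphic_on \<D>"
    using one_minus_nonzero_of_norm_less(1)[OF lt] by (intro holomorphic_intros \<phi>) auto
  obtain f where f: "f \<in> \<A>" "locally_univalent f"
    and P: "\<And>z. cmod z < 1 \<Longrightarrow>
      deriv (deriv f) z / deriv f z = 2 * ?k * \<phi> z / (1 - z * \<phi> z)"
    using prescribed_log_deriv_deriv[OF hol] by blast
  have "Re (exp (\<i> * of_real \<alpha>) * (1 + z * deriv (deriv f) z / deriv f z)) > \<beta> * cos \<alpha>"
    if z: "cmod z < 1" for z
  proof -
    let ?w = "z * \<phi> z"
    have "exp (\<i> * of_real \<alpha>) * (1 + z * deriv (deriv f) z / deriv f z)
        = exp (\<i> * of_real \<alpha>) + (exp (\<i> * of_real \<alpha>) * ?k) * (2 * (?w / (1 - ?w)))"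
      unfolding times_divide_eq_right[symmetric, of z] P[OF z]
      by (simp add: algebra_simps)
    also have "Re \<dots> = cos \<alpha> + 2 * c * Re (?w / (1 - ?w))"
      unfolding exp_spiral_coeff c_def[symmetric] plus_complex.sel
      by (simp only: times_complex.sel Re_exp) simp
    also have "\<dots> > cos \<alpha> + 2 * c * (- 1 / 2)"
      using mult_strict_left_mono[OF Re_divide_one_minus_gt[OF lt[OF z]], of "2 * c"] c by simp
    finally show ?thesis
      by (simp add: c_def algebra_simps)
  qed
  then have "f \<in> S_class \<alpha> \<beta>"
    using f by (auto simp: S_class_def)
  then show thesis using P by (rule that)
qed

section \<open>The Schwarzian derivative in terms of the self-map\<close>

lemma schwarzian_of_representation:
  assumes hol: "\<phi> holomorphic_on \<D>" and bd: "\<And>z. cmod z < 1 \<Longrightarrow> cmod (\<phi> z) \<le> 1"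
    and P: "\<And>z. cmod z < 1 \<Longrightarrow>
      deriv (deriv f) z / deriv f z = 2 * k * \<phi> z / (1 - z * \<phi> z)"
    and z: "cmod z < 1"
  shows "schwarzian f z = 2 * k * (deriv \<phi> z + (1 - k) * (\<phi> z)\<^sup>2) / (1 - z * \<phi> z)\<^sup>2"
proof -
  have nz: "1 - z * \<phi> z \<noteq> 0"
    using norm_mult_less_one[OF z bd[OF z]] by auto
  have d: "(\<phi> has_field_derivative deriv \<phi> z) (at z)"
    using hol z by (intro holomorphic_derivI[of _ \<D>]) auto
  have "((\<lambda>z. 2 * k * \<phi> z / (1 - z * \<phi> z)) has_field_derivative
      2 * k * (deriv \<phi> z + (\<phi> z)\<^sup>2) / (1 - z * \<phi> z)\<^sup>2) (at z)"
    by (rule derivative_eq_intros d refl nz)+ (simp add: algebra_simps power2_eq_square)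
  then have "deriv (\<lambda>w. deriv (deriv f) w / deriv f w) z
      = 2 * k * (deriv \<phi> z + (\<phi> z)\<^sup>2) / (1 - z * \<phi> z)\<^sup>2"
    by (rule DERIV_imp_deriv[OF has_field_derivative_transform_within_open[of _ _ _ \<D>]])
       (use z in \<open>simp_all only: open_ball mem_ball_0 P\<close>)
  then have "schwarzian f z
      = (2 * k * (deriv \<phi> z + (\<phi> z)\<^sup>2) - 1 / 2 * (2 * k * \<phi> z)\<^sup>2) / (1 - z * \<phi> z)\<^sup>2"
    unfolding schwarzian_def P[OF z] by (simp add: power_divide diff_divide_distrib)
  also have "2 * k * (deriv \<phi> z + (\<phi> z)\<^sup>2) - 1 / 2 * (2 * k * \<phi> z)\<^sup>2
      = 2 * k * (deriv \<phi> z + (1 - k) * (\<phi> z)\<^sup>2)"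
    by (simp add: algebra_simps power2_eq_square)
  finally show ?thesis .
qed

text \<open>
  The coordinate \<open>u\<close> is the signed pseudo-hyperbolic distance of \<open>r\<close> and \<open>t\<close>; the identity
  rests on \<open>(1 - r\<^sup>2) (1 - t\<^sup>2) = (1 - r t)\<^sup>2 - (t - r)\<^sup>2\<close> and
  \<open>u + r = t (1 - r\<^sup>2) / (1 - r t)\<close>.
\<close>

lemma pseudo_hyperbolic_identity:
  fixes r t d :: real
  assumes "1 - r * t \<noteq> 0"
  defines "u \<equiv> (t - r) / (1 - r * t)"
  shows "(1 - r\<^sup>2) * ((1 - t\<^sup>2) + d * t\<^sup>2 * (1 - r\<^sup>2)) / (1 - r * t)\<^sup>2 = 1 - u\<^sup>2 + d * (u + r)\<^sup>2"
proof -
  have ur: "u + r = t * (1 - r\<^sup>2) / (1 - r * t)"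
    using assms(1) by (simp add: u_def field_simps power2_eq_square)
  have "1 - u\<^sup>2 + d * (u + r)\<^sup>2
      = ((1 - r * t)\<^sup>2 - (t - r)\<^sup>2 + d * (t * (1 - r\<^sup>2))\<^sup>2) / (1 - r * t)\<^sup>2"
    unfolding ur using assms(1)
    by (simp add: u_def power_divide add_divide_distrib diff_divide_distrib[of "_ + _"]
        diff_divide_distrib[of "(1 - r * t)\<^sup>2"])
  also have "(1 - r * t)\<^sup>2 - (t - r)\<^sup>2 + d * (t * (1 - r\<^sup>2))\<^sup>2
      = (1 - r\<^sup>2) * ((1 - t\<^sup>2) + d * t\<^sup>2 * (1 - r\<^sup>2))"
    by algebra
  finally show ?thesis by simp
qed

text \<open>
  Maximizing \<open>1 - u\<^sup>2 + d (u + 1)\<^sup>2\<close> over \<open>[-1, 1]\<close>: the vertex of the parabola is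
  \<open>u = d / (1 - d)\<close>.
\<close>

definition quadratic_max :: "real \<Rightarrow> real"
  where "quadratic_max d = (if d \<le> 1 / 2 then 1 / (1 - d) else 4 * d)"

definition quadratic_argmax :: "real \<Rightarrow> real"
  where "quadratic_argmax d = (if d \<le> 1 / 2 then d / (1 - d) else 1)"

lemma quadratic_le_max:
  fixes u d :: real
  assumes "- 1 \<le> u" "u \<le> 1"
  shows "1 - u\<^sup>2 + d * (u + 1)\<^sup>2 \<le> quadratic_max d"
proof (cases "d \<le> 1 / 2")
  case True
  have "1 - (1 - d) * (1 - u\<^sup>2 + d * (u + 1)\<^sup>2) = (d - (1 - d) * u)\<^sup>2"
    by algebra
  then have "(1 - d) * (1 - u\<^sup>2 + d * (u + 1)\<^sup>2) \<le> 1"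
    using zero_le_power2[of "d - (1 - d) * u"] by linarith
  then show ?thesis
    using True by (simp add: quadratic_max_def pos_le_divide_eq mult.commute)
next
  case False
  have "0 \<le> (d - 1 / 2) * (3 + u)"
    using False assms by (intro mult_nonneg_nonneg) auto
  then have "1 + u \<le> d * (3 + u)"
    using assms by (simp add: algebra_simps)
  then have "0 \<le> (1 - u) * (d * (3 + u) - (1 + u))"
    using assms by (intro mult_nonneg_nonneg) auto
  also have "\<dots> = 4 * d - (1 - u\<^sup>2 + d * (u + 1)\<^sup>2)"
    by algebra
  finally show ?thesis
    using False by (simp add: quadratic_max_def)
qed

lemma quadratic_at_argmax:
  "1 - (quadratic_argmax d)\<^sup>2 + d * (quadratic_argmax d + 1)\<^sup>2 = quadratic_max d"
proof (cases "d \<le> 1 / 2")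
  case True
  then have "1 - d \<noteq> 0" by simp
  then have "1 - (d / (1 - d))\<^sup>2 + d * (d / (1 - d) + 1)\<^sup>2 = 1 / (1 - d)"
    by (simp add: divide_simps) algebra
  then show ?thesis
    using True by (simp add: quadratic_argmax_def quadratic_max_def)
qed (simp add: quadratic_argmax_def quadratic_max_def)

lemma quadratic_argmax_bounds:
  assumes "0 \<le> d"
  shows "0 \<le> quadratic_argmax d" "quadratic_argmax d \<le> 1"
  using assms by (auto simp: quadratic_argmax_def)

lemma schwarzian_bound_eq:
  "schwarzian_bound \<alpha> \<beta> =
    2 * ((1 - \<beta>) * cos \<alpha>) * quadratic_max (cmod (1 - spiral_coeff \<alpha> \<beta>))"
proof -
  let ?q = "(sin \<alpha>)\<^sup>2 + \<beta>\<^sup>2 * (cos \<alpha>)\<^sup>2"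
  have "sqrt ?q \<le> 1 / 2 \<longleftrightarrow> sqrt ?q \<le> sqrt (1 / 4)"
    by (simp add: real_sqrt_divide)
  also have "\<dots> \<longleftrightarrow> ?q \<le> 1 / 4"
    by (rule real_sqrt_le_iff)
  finally show ?thesis
    unfolding schwarzian_bound_def norm_one_minus_spiral_coeff quadratic_max_def by simp
qed

section \<open>The estimate and its sharpness\<close>

lemma pseudo_hyperbolic_bound:
  fixes r t d :: real
  assumes r: "0 \<le> r" "r < 1" and t: "0 \<le> t" "t \<le> 1" and d: "0 \<le> d"
  shows "(1 - r\<^sup>2) * ((1 - t\<^sup>2) + d * t\<^sup>2 * (1 - r\<^sup>2)) / (1 - r * t)\<^sup>2 \<le> quadratic_max d"
proof -
  define u where "u = (t - r) / (1 - r * t)"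
  have rt: "r * t < 1"
    using mult_left_le[of t r] r t by linarith
  have "0 \<le> (1 + r) * (1 - t)" "0 \<le> (1 - r) * (1 + t)"
    using r t by auto
  then have u: "- 1 \<le> u" "u \<le> 1"
    using rt by (auto simp: u_def divide_simps algebra_simps)
  have "u + r = t * (1 - r\<^sup>2) / (1 - r * t)"
    using rt by (simp add: u_def field_simps power2_eq_square)
  then have "0 \<le> u + r"
    using r t rt by (simp add: power_le_one)
  then have "d * (u + r)\<^sup>2 \<le> d * (u + 1)\<^sup>2"
    using r d by (intro mult_left_mono power_mono) auto
  then have "1 - u\<^sup>2 + d * (u + r)\<^sup>2 \<le> quadratic_max d"
    using quadratic_le_max[OF u, of d] by linarith
  then show ?thesis
    using pseudo_hyperbolic_identity[of r t d] rt by (simp add: u_def)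
qed

lemma schwarzian_norm_le:
  assumes \<alpha>: "0 < cos \<alpha>" and \<beta>: "\<beta> < 1" and f: "f \<in> S_class \<alpha> \<beta>"
  shows "schwarzian_norm f \<le> ereal (schwarzian_bound \<alpha> \<beta>)"
proof -
  define k where "k = spiral_coeff \<alpha> \<beta>"
  define d where "d = cmod (1 - k)"
  obtain \<phi> where hol: "\<phi> holomorphic_on \<D>" and bd: "\<And>z. cmod z < 1 \<Longrightarrow> cmod (\<phi> z) \<le> 1"
    and P: "\<And>z. cmod z < 1 \<Longrightarrow> deriv (deriv f) z / deriv f z = 2 * k * \<phi> z / (1 - z * \<phi> z)"
    using S_class_representation[OF \<alpha> \<beta> f] unfolding k_def by metis
  have "(1 - (cmod z)\<^sup>2)\<^sup>2 * cmod (schwarzian f z) \<le> schwarzian_bound \<alpha> \<beta>"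
    if z: "cmod z < 1" for z
  proof -
    define r where "r = cmod z"
    define t where "t = cmod (\<phi> z)"
    have r: "0 \<le> r" "r < 1" and t: "0 \<le> t" "t \<le> 1"
      using z bd by (auto simp: r_def t_def)
    have r2: "0 < 1 - r\<^sup>2" using r by (simp add: power_less_one_iff)
    have rt: "r * t < 1"
      using mult_left_le[of t r] r t by linarith
    have "cmod (deriv \<phi> z + (1 - k) * (\<phi> z)\<^sup>2) \<le> cmod (deriv \<phi> z) + d * t\<^sup>2"
      using norm_triangle_ineq[of "deriv \<phi> z" "(1 - k) * (\<phi> z)\<^sup>2"]
      by (simp add: norm_mult norm_power d_def t_def)
    then have "(1 - r\<^sup>2) * cmod (deriv \<phi> z + (1 - k) * (\<phi> z)\<^sup>2)
        \<le> (1 - r\<^sup>2) * (cmod (deriv \<phi> z) + d * t\<^sup>2)"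
      using r2 by (intro mult_left_mono) auto
    also have "\<dots> \<le> (1 - t\<^sup>2) + d * t\<^sup>2 * (1 - r\<^sup>2)"
      using Schwarz_Pick[OF hol bd z] by (simp add: r_def t_def algebra_simps)
    finally have num: "(1 - r\<^sup>2) * cmod (deriv \<phi> z + (1 - k) * (\<phi> z)\<^sup>2)
        \<le> (1 - t\<^sup>2) + d * t\<^sup>2 * (1 - r\<^sup>2)" .
    have "1 - r * t \<le> cmod (1 - z * \<phi> z)"
      using norm_triangle_ineq2[of 1 "z * \<phi> z"] by (simp add: norm_mult r_def t_def)
    then have den: "(1 - r * t)\<^sup>2 \<le> (cmod (1 - z * \<phi> z))\<^sup>2"
      using rt by (intro power_mono) auto
    have "(1 - (cmod z)\<^sup>2)\<^sup>2 * cmod (schwarzian f z)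
        = 2 * cmod k * ((1 - r\<^sup>2) * ((1 - r\<^sup>2) * cmod (deriv \<phi> z + (1 - k) * (\<phi> z)\<^sup>2))
            / (cmod (1 - z * \<phi> z))\<^sup>2)"
      by (subst schwarzian_of_representation[OF hol bd P z], assumption+)
         (simp add: norm_mult norm_divide norm_power r_def power2_eq_square)
    also have "\<dots> \<le> 2 * cmod k * ((1 - r\<^sup>2) * ((1 - t\<^sup>2) + d * t\<^sup>2 * (1 - r\<^sup>2)) / (1 - r * t)\<^sup>2)"
    proof (intro mult_left_mono frac_le)
      have "0 \<le> d" "t\<^sup>2 \<le> 1" using t by (auto simp: d_def power_le_one)
      then show "0 \<le> (1 - r\<^sup>2) * ((1 - t\<^sup>2) + d * t\<^sup>2 * (1 - r\<^sup>2))"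
        using r2 by (intro mult_nonneg_nonneg add_nonneg_nonneg) auto
    qed (use r2 num den rt in auto)
    also have "\<dots> \<le> 2 * cmod k * quadratic_max d"
      by (intro mult_left_mono pseudo_hyperbolic_bound r t) (auto simp: d_def)
    also have "\<dots> = schwarzian_bound \<alpha> \<beta>"
      unfolding schwarzian_bound_eq using norm_spiral_coeff[OF \<alpha> \<beta>] by (simp add: k_def d_def)
    finally show ?thesis .
  qed
  then show ?thesis
    unfolding schwarzian_norm_def by (intro SUP_least) auto
qed

text \<open>
  For fixed \<open>r < 1\<close> and \<open>u\<close>, take \<open>\<phi>\<close> with \<open>\<phi> r = t\<close>, where \<open>t = (u + r) / (1 + u r)\<close> inverts the
  coordinate change, and with \<open>\<phi>' r\<close> as large as the Schwarz-Pick inequality allows and pointing in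
  the direction of \<open>1 - k\<close>. Then both triangle inequalities of the upper estimate are equalities at
  \<open>z = r\<close>.
\<close>

lemma schwarzian_norm_attained_at:
  fixes r u :: real
  assumes \<alpha>: "0 < cos \<alpha>" and \<beta>: "\<beta> < 1" and r: "0 < r" "r < 1" and u: "0 \<le> u" "u \<le> 1"
  obtains f where "f \<in> S_class \<alpha> \<beta>"
    "ereal (2 * ((1 - \<beta>) * cos \<alpha>) * (1 - u\<^sup>2 + cmod (1 - spiral_coeff \<alpha> \<beta>) * (u + r)\<^sup>2))
      \<le> schwarzian_norm f"
proof -
  define k where "k = spiral_coeff \<alpha> \<beta>"
  define d where "d = cmod (1 - k)"
  \<comment> \<open>The fallback \<open>1\<close> only serves to have a unimodular number when \<open>k = 1\<close>.\<close>
  define \<epsilon> where "\<epsilon> = (if k = 1 then 1 else sgn (1 - k))"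
  define t where "t = (u + r) / (1 + u * r)"
  have \<epsilon>: "cmod \<epsilon> = 1"
    by (simp add: \<epsilon>_def norm_sgn)
  have \<epsilon>d: "1 - k = \<epsilon> * of_real d"
    by (simp add: \<epsilon>_def d_def sgn_eq)
  have pos: "0 < 1 + u * r" using r u by (simp add: add_pos_nonneg)
  have "0 \<le> (1 - u) * (1 - r)" using r u by simp
  then have t: "0 \<le> t" "t \<le> 1"
    using pos r u by (auto simp: t_def divide_simps algebra_simps)
  have rt: "r * t < 1"
    using mult_left_le[of t r] r t by linarith
  have ut: "(t - r) / (1 - r * t) = u"
  proof -
    have "r\<^sup>2 < 1" using r by (simp add: power_less_one_iff)
    have "t - r = u * (1 - r\<^sup>2) / (1 + u * r)" "1 - r * t = (1 - r\<^sup>2) / (1 + u * r)"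
      using pos by (simp_all add: t_def field_simps power2_eq_square)
    then show ?thesis using pos \<open>r\<^sup>2 < 1\<close> by simp
  qed
  have rc: "cmod (of_real r) < 1" using r by simp
  have r2: "0 < 1 - r\<^sup>2" using r by (simp add: power_less_one_iff)
  obtain \<phi> where hol: "\<phi> holomorphic_on \<D>" and bd: "\<And>z. cmod z < 1 \<Longrightarrow> cmod (\<phi> z) \<le> 1"
    and v: "\<phi> (of_real r) = of_real t"
    and v': "deriv \<phi> (of_real r) = \<epsilon> * of_real ((1 - t\<^sup>2) / (1 - r\<^sup>2))"
    using Schwarz_Pick_extremal[OF rc t \<epsilon>] r by auto
  obtain f where f: "f \<in> S_class \<alpha> \<beta>"
    and P: "\<And>z. cmod z < 1 \<Longrightarrow> deriv (deriv f) z / deriv f z = 2 * k * \<phi> z / (1 - z * \<phi> z)"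
    using S_class_construction[OF \<alpha> \<beta> hol bd] unfolding k_def by metis
  let ?X = "(1 - t\<^sup>2) / (1 - r\<^sup>2) + d * t\<^sup>2"
  have X: "0 \<le> ?X" using t r2 by (simp add: d_def power_le_one)
  have "schwarzian f (of_real r) = 2 * k *
      (deriv \<phi> (of_real r) + (1 - k) * (\<phi> (of_real r))\<^sup>2) / (1 - of_real r * \<phi> (of_real r))\<^sup>2"
    by (rule schwarzian_of_representation[OF hol bd P rc])
  also have "\<dots> = 2 * k * (\<epsilon> * of_real ?X) / of_real ((1 - r * t)\<^sup>2)"
    unfolding v v' \<epsilon>d by (simp add: distrib_left mult.assoc)
  finally have "cmod (schwarzian f (of_real r)) = 2 * cmod k * ?X / (1 - r * t)\<^sup>2"
    using X by (simp only: norm_divide norm_mult norm_of_real \<epsilon>) simp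
  then have "(1 - r\<^sup>2)\<^sup>2 * cmod (schwarzian f (of_real r))
      = 2 * cmod k * ((1 - r\<^sup>2) * ((1 - r\<^sup>2) * ?X) / (1 - r * t)\<^sup>2)"
    by (simp add: power2_eq_square)
  also have "(1 - r\<^sup>2) * ?X = (1 - t\<^sup>2) + d * t\<^sup>2 * (1 - r\<^sup>2)"
    using r2 by (simp add: field_simps)
  also have "2 * cmod k * ((1 - r\<^sup>2) * ((1 - t\<^sup>2) + d * t\<^sup>2 * (1 - r\<^sup>2)) / (1 - r * t)\<^sup>2)
      = 2 * cmod k * (1 - u\<^sup>2 + d * (u + r)\<^sup>2)"
    using pseudo_hyperbolic_identity[of r t d] rt by (simp add: ut)
  finally have eq: "(1 - (cmod (of_real r))\<^sup>2)\<^sup>2 * cmod (schwarzian f (of_real r))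
      = 2 * ((1 - \<beta>) * cos \<alpha>) * (1 - u\<^sup>2 + cmod (1 - spiral_coeff \<alpha> \<beta>) * (u + r)\<^sup>2)"
    using norm_spiral_coeff[OF \<alpha> \<beta>] by (simp add: k_def d_def)
  show thesis
  proof (rule that[OF f])
    show "ereal (2 * ((1 - \<beta>) * cos \<alpha>) * (1 - u\<^sup>2 + cmod (1 - spiral_coeff \<alpha> \<beta>) * (u + r)\<^sup>2))
        \<le> schwarzian_norm f"
      unfolding schwarzian_norm_def eq[symmetric] by (rule SUP_upper) (use rc in simp)
  qed
qed

lemma schwarzian_bound_sharp:
  assumes \<alpha>: "0 < cos \<alpha>" and \<beta>: "\<beta> < 1"
    and M: "\<forall>f\<in>S_class \<alpha> \<beta>. schwarzian_norm f \<le> ereal M"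
  shows "schwarzian_bound \<alpha> \<beta> \<le> M"
proof -
  define d where "d = cmod (1 - spiral_coeff \<alpha> \<beta>)"
  define u where "u = quadratic_argmax d"
  have u: "0 \<le> u" "u \<le> 1"
    using quadratic_argmax_bounds[of d] by (auto simp: u_def d_def)
  define h where "h = (\<lambda>r. 2 * ((1 - \<beta>) * cos \<alpha>) * (1 - u\<^sup>2 + d * (u + r)\<^sup>2))"
  have "h r \<le> M" if r: "0 < r" "r < 1" for r
  proof -
    obtain f where "f \<in> S_class \<alpha> \<beta>" "ereal (h r) \<le> schwarzian_norm f"
      using schwarzian_norm_attained_at[OF \<alpha> \<beta> r u] unfolding h_def d_def by metis
    then show ?thesis
      using M order_trans[of "ereal (h r)" "schwarzian_norm f" "ereal M"] by auto
  qed
  then have "eventually (\<lambda>r. h r \<le> M) (at_left 1)"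
    using eventually_mono[OF eventually_at_left_real[of 0 "1::real"]] by simp
  moreover have "(h \<longlongrightarrow> h 1) (at_left 1)"
    unfolding h_def by (intro tendsto_intros)
  ultimately have "h 1 \<le> M"
    by (intro tendsto_upperbound[OF _ _ trivial_limit_at_left_real]) auto
  then show ?thesis
    unfolding schwarzian_bound_eq h_def using quadratic_at_argmax[of d]
    by (simp add: u_def d_def)
qed

theorem theorem2p2:
  fixes \<alpha> \<beta> :: real
  assumes "- pi / 2 < \<alpha>" and "\<alpha> < pi / 2" and "0 \<le> \<beta>" and "\<beta> < 1"
  shows "(\<forall>f\<in>S_class \<alpha> \<beta>. schwarzian_norm f \<le> ereal (schwarzian_bound \<alpha> \<beta>)) \<and>
    \<not> (\<exists>M::real. M < schwarzian_bound \<alpha> \<beta> \<and>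
      (\<forall>f\<in>S_class \<alpha> \<beta>. schwarzian_norm f \<le> ereal M))"
proof -
  have "0 < cos \<alpha>"
    using assms by (intro cos_gt_zero_pi) auto
  then show ?thesis
    using schwarzian_norm_le schwarzian_bound_sharp \<open>\<beta> < 1\<close> by (meson not_le)
qed

end
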